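(* Suppose that $A,B\subseteq\mathbb{N}$ satisfy $\operatorname{\ell BD}(A)>0$ and $\operatorname{\ell BD}(B)>0$. Then there exists $m\in\mathbb{N}$ such that for all $n\in\mathbb{N}$ there is $x\in\mathbb{N}$ such that for every interval $[u,mu]\subseteq[x,nx]$ we have $[u,mu]\cap(A\cdot B)\neq\emptyset$.
   Context: $\mathbb{N}=\{1,2,3,\dots\}$; $A\cdot B=\{ab: a\in A, b\in B\}$. For $A\subseteq\mathbb{N}$, the (upper) Banach log density is $\operatorname{\ell BD}(A)=\lim_{n\to\infty}\sup_{k\ge1}\frac{1}{\ln n}\sum_{x\in A\cap[k,nk]}\frac1x$ (this limit exists). *)

theory Defs
  imports Complex_Main "HOL-Library.Set_Algebras"
begin

definition lBD :: "nat set \<Rightarrow> real" where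
  "lBD A = lim (\<lambda>n::nat. SUP k\<in>{1::nat..}.
      1 / ln (real n) * (\<Sum>x\<in>A \<inter> {k..n * k}. 1 / real x))"

end

theory Submission
  imports Defs "HOL-Library.Discrete_Functions" "HOL-Library.Disjoint_Sets"
begin

text \<open>
  Replacing every element by the integer part of its binary logarithm turns products into sums, up
  to an error of 1, and positive Banach log density into positive upper Banach density. It thus
  suffices to show Jin's theorem that the sumset of two sets \<open>X\<close>, \<open>Y\<close> of integers of
  positive upper Banach density is piecewise syndetic.

  By pigeonhole, some \<open>s\<close> makes \<open>C = X \<inter> (s - Y)\<close> large, and \<open>s + (C - C) \<subseteq> X + Y\<close>.
  A maximal family \<open>T\<close> of shifts \<open>t\<close> in \<open>[0, N)\<close> with \<open>t + C\<close> pairwise disjoint has a size bounded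
  in terms of the two densities only, and by maximality the translates of \<open>X + Y\<close> by \<open>T\<close> cover
  \<open>[s, s + N)\<close>. If \<open>X + Y\<close> were not piecewise syndetic, then nesting gaps would show that
  boundedly many translates of it cannot cover a sufficiently long interval.
\<close>

section \<open>Covering an interval by few translates of a sumset\<close>

text \<open>Double counting: every sum of an element of \<open>X\<close> and one of \<open>Y\<close>
  lies in a window of L + M integers, so some sum \<open>s\<close> is attained at least as often as
  the average.\<close>

lemma popular_sum:
  fixes X Y :: "int set" and L M :: nat
  assumes X: "X \<subseteq> {p..<p + int L}" and Y: "Y \<subseteq> {q..<q + int M}"
  shows "\<exists>s. card X * card Y \<le> (L + M) * card {x \<in> X. s - x \<in> Y}"
proof (rule ccontr)
  assume "\<not> ?thesis"
  then have less: "(L + M) * card {x \<in> X. s - x \<in> Y} < card X * card Y" for s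
    by (simp add: not_le)
  have fin: "finite X" "finite Y"
    using X Y by (auto intro: finite_subset)
  define J where "J = {p + q..<p + q + int (L + M)}"
  have "card {s \<in> J. s - x \<in> Y} = card Y" if "x \<in> X" for x
  proof -
    have "{s \<in> J. s - x \<in> Y} = (\<lambda>y. x + y) ` Y"
    proof (intro subset_antisym subsetI)
      fix s assume "s \<in> {s \<in> J. s - x \<in> Y}"
      then show "s \<in> (\<lambda>y. x + y) ` Y"
        by (intro image_eqI[of _ _ "s - x"]) auto
    next
      fix s assume "s \<in> (\<lambda>y. x + y) ` Y"
      then obtain y where "y \<in> Y" "s = x + y" by auto
      moreover have "x \<in> {p..<p + int L}" "y \<in> {q..<q + int M}"
        using X Y that \<open>y \<in> Y\<close> by blast+
      ultimately show "s \<in> {s \<in> J. s - x \<in> Y}"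
        by (auto simp: J_def)
    qed
    then show ?thesis by (simp add: card_image)
  qed
  moreover have "(\<Sum>s\<in>J. card {x \<in> X. s - x \<in> Y}) = (\<Sum>x\<in>X. card {s \<in> J. s - x \<in> Y})"
    by (rule sum_multicount_gen) (use fin in \<open>auto simp: J_def\<close>)
  ultimately have total: "(\<Sum>s\<in>J. card {x \<in> X. s - x \<in> Y}) = card X * card Y"
    by simp
  \<comment> \<open>Strictness of the summed inequality requires \<open>J\<close> to be nonempty. If
    L + M = 0, then \<open>X\<close> is empty and \<open>less\<close> reads 0 < 0.\<close>
  show False
  proof (cases "L + M = 0")
    case True
    then show False using less[of 0] X by simp
  next
    case False
    have "(\<Sum>s\<in>J. (L + M) * card {x \<in> X. s - x \<in> Y}) < (\<Sum>s\<in>J. card X * card Y)"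
      by (rule sum_strict_mono) (use False less in \<open>auto simp: J_def\<close>)
    also have "\<dots> = (L + M) * (card X * card Y)"
      by (simp add: J_def nat_add_distrib)
    finally show False
      by (simp add: total flip: sum_distrib_left)
  qed
qed

text \<open>Disjoint translates of \<open>C\<close> by shifts in [0, N) fit into a window of L + N
  integers, which bounds \<open>card T\<close>. For maximal \<open>T\<close>, a shift
  \<open>u\<close> outside \<open>T\<close> makes \<open>u + C\<close> meet some
  \<open>t + C\<close>; for \<open>u\<close> in \<open>T\<close>, take t = u and c = d.\<close>

lemma maximal_disjoint_translates:
  fixes C :: "int set" and L N :: nat
  assumes C: "C \<subseteq> {p..<p + int L}" "C \<noteq> {}"
  shows "\<exists>T. finite T \<and> card T * card C \<le> L + N \<and>
    (\<forall>u\<in>{0..<int N}. \<exists>t\<in>T. \<exists>c\<in>C. \<exists>d\<in>C. u + c = t + d)"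
proof -
  define disj where "disj T \<longleftrightarrow> disjoint_family_on (\<lambda>t. (+) t ` C) T" for T :: "int set"
  define F where "F = {T. T \<subseteq> {0..<int N} \<and> disj T}"
  have "finite F"
    by (rule finite_subset[of _ "Pow {0..<int N}"]) (auto simp: F_def)
  moreover have "{} \<in> F"
    by (simp add: F_def disj_def disjoint_family_on_def)
  ultimately obtain T where T: "T \<in> F" and max: "\<And>T'. T' \<in> F \<Longrightarrow> T \<subseteq> T' \<Longrightarrow> T = T'"
    using finite_has_maximal[of F] by blast
  have fin: "finite C" "finite T"
    using C T by (auto simp: F_def intro: finite_subset)
  have "card T * card C = card (\<Union>t\<in>T. (+) t ` C)"
    using T fin by (subst card_UN_disjoint')
      (auto simp: F_def disj_def card_image)
  also have "\<dots> \<le> card {p..<p + int (L + N)}"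
  proof (intro card_mono subsetI)
    fix z assume "z \<in> (\<Union>t\<in>T. (+) t ` C)"
    then obtain t c where "t \<in> T" "c \<in> C" "z = t + c" by auto
    moreover have "t \<in> {0..<int N}" "c \<in> {p..<p + int L}"
      using T C \<open>t \<in> T\<close> \<open>c \<in> C\<close> by (auto simp: F_def)
    ultimately show "z \<in> {p..<p + int (L + N)}" by auto
  qed simp
  also have "\<dots> = L + N" by (simp add: nat_add_distrib)
  finally have "card T * card C \<le> L + N" .
  moreover have "\<exists>t\<in>T. \<exists>c\<in>C. \<exists>d\<in>C. u + c = t + d" if u: "u \<in> {0..<int N}" for u
  proof (cases "u \<in> T")
    case True
    then show ?thesis using C(2) by blast
  next
    case False
    then have "insert u T \<notin> F"
      using max[of "insert u T"] by blast
    then have "\<not> disj (insert u T)"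
      using T u by (auto simp: F_def)
    then have "\<exists>t\<in>T. (+) u ` C \<inter> (+) t ` C \<noteq> {}"
      using T False by (auto simp: F_def disj_def disjoint_family_on_insert)
    then show ?thesis by auto
  qed
  ultimately show ?thesis using fin by blast
qed

text \<open>The point is a bound on \<open>card T\<close> independent of \<open>N\<close>. As L + M
  \<le> 2M, the popular sum gives a set \<open>C\<close> of size at least abL/2; as N \<le> L,
  \<open>card T * card C\<close> is at most 2L.\<close>

lemma interval_covered_by_translates_of_sumset:
  fixes X Y :: "int set" and L M N :: nat
  assumes X: "X \<subseteq> {p..<p + int L}" and Y: "Y \<subseteq> {q..<q + int M}"
    and cX: "a * real L \<le> card X" and cY: "b * real M \<le> card Y"
    and pos: "a > 0" "b > 0" and N: "N \<ge> 1" "N \<le> L" "L \<le> M"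
  shows "\<exists>s T. finite T \<and> real (card T) \<le> 4 / (a * b) \<and>
    (\<forall>z\<in>{s..<s + int N}. \<exists>t\<in>T. z - t \<in> X + Y)"
proof -
  obtain s where s: "card X * card Y \<le> (L + M) * card {x \<in> X. s - x \<in> Y}"
    using popular_sum[OF X Y] by blast
  define C where "C = {x \<in> X. s - x \<in> Y}"
  have "(a * real L) * (b * real M) \<le> real (card X) * real (card Y)"
    using cX cY pos by (intro mult_mono) auto
  also have "\<dots> \<le> real (L + M) * card C"
    using s unfolding C_def of_nat_mult[symmetric] of_nat_le_iff .
  also have "\<dots> \<le> (2 * real M) * card C"
    using N by (intro mult_right_mono) auto
  finally have "(a * b * L) * real M \<le> (2 * card C) * real M"
    by (simp add: algebra_simps)
  then have C: "a * b * L \<le> 2 * card C"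
    using N by (subst (asm) mult_le_cancel_right_pos) auto
  have "0 < a * b * L" using pos N by simp
  with C have "card C > 0" by linarith
  then have "C \<noteq> {}" by auto
  moreover have "C \<subseteq> {p..<p + int L}" using X by (auto simp: C_def)
  ultimately obtain T where T: "finite T" "card T * card C \<le> L + N"
    and cov: "\<forall>u\<in>{0..<int N}. \<exists>t\<in>T. \<exists>c\<in>C. \<exists>d\<in>C. u + c = t + d"
    using maximal_disjoint_translates[of C p L N] by metis
  have "(card T * (a * b)) * real L = card T * (a * b * L)"
    by simp
  also have "\<dots> \<le> card T * (2 * card C)"
    using mult_left_mono[OF C, of "real (card T)"] by simp
  also have "\<dots> \<le> 2 * real (L + N)"
    using T(2) by (simp flip: of_nat_mult)
  also have "\<dots> \<le> 4 * real L" using N by simp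
  finally have "card T * (a * b) \<le> 4"
    using N by (subst (asm) mult_le_cancel_right_pos) auto
  then have "real (card T) \<le> 4 / (a * b)"
    using pos by (simp add: field_simps)
  moreover have "\<exists>t\<in>T. z - t \<in> X + Y" if "z \<in> {s..<s + int N}" for z
  proof -
    have "z - s \<in> {0..<int N}" using that by auto
    then obtain t c d where tcd: "t \<in> T" "c \<in> C" "d \<in> C" "z - s + c = t + d"
      using cov by blast
    \<comment> \<open>Since \<open>c\<close> and \<open>d\<close> lie in \<open>C\<close>,
      \<open>d\<close> is in \<open>X\<close> and \<open>s - c\<close> is in
      \<open>Y\<close>.\<close>
    have "z - t = d + (s - c)" using tcd(4) by simp
    also have "\<dots> \<in> X + Y"
      using tcd by (intro set_plus_intro) (auto simp: C_def)
    finally show ?thesis using tcd(1) by blast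
  qed
  ultimately show ?thesis using T(1) by blast
qed

section \<open>Gaps at all scales and piecewise syndeticity\<close>

text \<open>The hypothesis \<open>gaps\<close> is the failure of piecewise syndeticity. By induction
  on \<open>K\<close>: a gap of \<open>S\<close> whose length suffices for \<open>K\<close> shifts,
  moved by one shift \<open>t\<close>, avoids \<open>t + S\<close> entirely, and inside it the
  remaining shifts miss a point.\<close>

lemma few_translates_miss_point:
  fixes S :: "int set"
  assumes gaps: "\<And>m::nat. m \<ge> 1 \<Longrightarrow> \<exists>n::nat. \<forall>x. \<exists>y\<ge>x. y + int m \<le> x + int n \<and> {y..<y + int m} \<inter> S = {}"
  shows "\<exists>N::nat\<ge>1. \<forall>T x. finite T \<and> card T \<le> K \<longrightarrow> (\<exists>z\<in>{x..<x + int N}. \<forall>t\<in>T. z - t \<notin> S)"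
proof (induction K)
  case 0
  show ?case
    by (rule exI[of _ 1]) auto
next
  case (Suc K)
  then obtain N :: nat where N: "N \<ge> 1" "\<And>T x. finite T \<Longrightarrow> card T \<le> K \<Longrightarrow> \<exists>z\<in>{x..<x + int N}. \<forall>t\<in>T. z - t \<notin> S"
    by blast
  obtain n :: nat where n: "\<And>x. \<exists>y\<ge>x. y + int N \<le> x + int n \<and> {y..<y + int N} \<inter> S = {}"
    using gaps[OF N(1)] by blast
  have "n \<ge> 1" using n[of 0] N(1) by auto
  moreover have "\<exists>z\<in>{x..<x + int n}. \<forall>t\<in>T. z - t \<notin> S" if T: "finite T" "card T \<le> Suc K" for T x
  proof (cases "T = {}")
    case True
    then show ?thesis using \<open>n \<ge> 1\<close> by (intro bexI[of _ x]) auto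
  next
    case False
    then obtain t where t: "t \<in> T" by blast
    \<comment> \<open>Searching from x - t puts the gap inside {x..<x + int n} once it is moved by
      \<open>t\<close>.\<close>
    obtain y where y: "y \<ge> x - t" "y + int N \<le> x - t + int n" "{y..<y + int N} \<inter> S = {}"
      using n by blast
    obtain z where z: "z \<in> {y + t..<y + t + int N}" "\<forall>t'\<in>T - {t}. z - t' \<notin> S"
      using N(2)[of "T - {t}" "y + t"] T t by (auto simp: le_diff_conv)
    have "z - t \<in> {y..<y + int N}" using z(1) by auto
    then have "z - t \<notin> S" using y(3) by blast
    then show ?thesis
      using z y by (intro bexI[of _ z]) auto
  qed
  ultimately show ?case by blast
qed

text \<open>Upper Banach density at least \<open>a\<close>, stated through arbitrarily long blocks
  so that no limit has to be handled.\<close>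

definition dense_blocks :: "real \<Rightarrow> int set \<Rightarrow> bool" where
  "dense_blocks a X \<longleftrightarrow> (\<forall>N::nat. \<exists>L\<ge>N. \<exists>p. a * real L \<le> card (X \<inter> {p..<p + int L}))"

text \<open>One long block of each set suffices. The shorter block has to come first; exchanging the
  two sets is harmless, as the sumset and the bound are symmetric.\<close>

lemma interval_covered_by_translates_of_dense_sumset:
  assumes "dense_blocks a X" "dense_blocks b Y" "a > 0" "b > 0" and N: "N \<ge> 1"
  shows "\<exists>s T. finite T \<and> real (card T) \<le> 4 / (a * b) \<and>
    (\<forall>z\<in>{s..<s + int N}. \<exists>t\<in>T. z - t \<in> X + Y)"
proof -
  obtain L p where L: "L \<ge> N" "a * real L \<le> card (X \<inter> {p..<p + int L})"
    using assms(1) unfolding dense_blocks_def by blast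
  obtain M q where M: "M \<ge> N" "b * real M \<le> card (Y \<inter> {q..<q + int M})"
    using assms(2) unfolding dense_blocks_def by blast
  have mono: "z \<in> X + Y" if "z \<in> X \<inter> I + Y \<inter> J" for z I J
    using that by (auto elim!: set_plus_elim)
  show ?thesis
  proof (cases "L \<le> M")
    case True
    show ?thesis
      using interval_covered_by_translates_of_sumset[OF Int_lower2 Int_lower2 L(2) M(2) assms(3,4) N L(1) True]
      by (meson mono)
  next
    case False
    then have "M \<le> L" by simp
    from interval_covered_by_translates_of_sumset[OF Int_lower2 Int_lower2 M(2) L(2) assms(4,3) N M(1) this]
    show ?thesis
      unfolding add.commute[of "Y \<inter> _"] mult.commute[of b] by (meson mono)
  qed
qed

theorem sumset_piecewise_syndetic:
  assumes "dense_blocks a X" "dense_blocks b Y" "a > 0" "b > 0"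
  shows "\<exists>m::nat\<ge>1. \<forall>n::nat. \<exists>x. \<forall>y\<ge>x. y + int m \<le> x + int n \<longrightarrow> {y..<y + int m} \<inter> (X + Y) \<noteq> {}"
proof (rule ccontr)
  assume "\<not> ?thesis"
  then have "\<exists>n::nat. \<forall>x. \<exists>y\<ge>x. y + int m \<le> x + int n \<and> {y..<y + int m} \<inter> (X + Y) = {}"
    if "m \<ge> 1" for m :: nat
    using that by meson
  \<comment> \<open>The number of translates is bounded before \<open>N\<close> is chosen, so the
    interval length can be taken from the gap argument and then covered.\<close>
  from few_translates_miss_point[OF this, of "nat \<lfloor>4 / (a * b)\<rfloor>"]
  obtain N :: nat where N: "N \<ge> 1"
    "\<And>T x. finite T \<Longrightarrow> card T \<le> nat \<lfloor>4 / (a * b)\<rfloor> \<Longrightarrow> \<exists>z\<in>{x..<x + int N}. \<forall>t\<in>T. z - t \<notin> X + Y"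
    by blast
  obtain s T where T: "finite T" "real (card T) \<le> 4 / (a * b)"
    "\<forall>z\<in>{s..<s + int N}. \<exists>t\<in>T. z - t \<in> X + Y"
    using interval_covered_by_translates_of_dense_sumset[OF assms N(1)] by blast
  have "card T \<le> nat \<lfloor>4 / (a * b)\<rfloor>"
    using T(2) by (simp add: le_nat_floor)
  then show False using N(2)[OF T(1)] T(3) by blast
qed

section \<open>From Banach log density to dense blocks of binary logarithms\<close>

text \<open>
  \<open>lim\<close> is a junk value on a divergent sequence, but a nonnegative sequence with no subsequence
  bounded away from 0 does converge, to 0.
\<close>
lemma lBD_pos_imp_dense_intervals:
  assumes "lBD A > 0"
  shows "\<exists>e>0. \<forall>N. \<exists>n\<ge>N. \<exists>k\<ge>1. e * ln (real n) \<le> (\<Sum>x\<in>A \<inter> {k..n * k}. 1 / real x)"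
proof (rule ccontr)
  assume *: "\<not> ?thesis"
  define g where "g n k = 1 / ln (real n) * (\<Sum>x\<in>A \<inter> {k..n * k}. 1 / real x)" for n k :: nat
  have g_nonneg: "g n k \<ge> 0" for n k
    unfolding g_def by (cases "n = 0") (auto intro!: divide_nonneg_nonneg sum_nonneg)
  have "(\<lambda>n. SUP k\<in>{1..}. g n k) \<longlonglongrightarrow> 0"
  proof (rule LIMSEQ_I)
    fix r :: real assume "r > 0"
    then obtain N where N: "\<And>n k. n \<ge> N \<Longrightarrow> k \<ge> 1 \<Longrightarrow> (\<Sum>x\<in>A \<inter> {k..n * k}. 1 / real x) < r / 2 * ln (real n)"
      using * by (metis half_gt_zero not_le)
    \<comment> \<open>The 2 makes \<open>ln n\<close> positive; the margin r / 2 keeps the bound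
      strict after passing to the supremum.\<close>
    have "norm ((SUP k\<in>{1..}. g n k) - 0) < r" if n: "n \<ge> max N 2" for n
    proof -
      have "ln (real n) > 0" using n by simp
      then have le: "g n k \<le> r / 2" if "k \<in> {1..}" for k
        using N[of n k] n that by (simp add: g_def field_simps)
      then have "(SUP k\<in>{1..}. g n k) \<le> r / 2"
        by (intro cSUP_least) auto
      moreover have "0 \<le> (SUP k\<in>{1..}. g n k)"
        using le g_nonneg by (intro cSUP_upper2[of _ _ 1] bdd_aboveI2[of _ _ "r / 2"]) auto
      ultimately show ?thesis using \<open>r > 0\<close> by simp
    qed
    then show "\<exists>N. \<forall>n\<ge>N. norm ((SUP k\<in>{1..}. g n k) - 0) < r" by blast
  qed
  then have "lBD A = 0"
    unfolding lBD_def g_def by (rule limI)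
  then show False using assms by simp
qed

lemma sum_inverse_dyadic_block_le: "(\<Sum>x\<in>{2 ^ i..<2 ^ Suc i}. 1 / real x) \<le> 1"
proof -
  have "(\<Sum>x\<in>{2 ^ i..<2 ^ Suc i}. 1 / real x) \<le> (\<Sum>x\<in>{2 ^ i..<(2::nat) ^ Suc i}. 1 / 2 ^ i)"
  proof (rule sum_mono)
    fix x :: nat assume "x \<in> {2 ^ i..<2 ^ Suc i}"
    then have "(2::real) ^ i \<le> real x" by simp
    then show "1 / real x \<le> 1 / 2 ^ i" by (intro divide_left_mono mult_pos_pos) (auto intro: less_le_trans[of _ "2 ^ i"])
  qed
  also have "\<dots> = 1" by simp
  finally show ?thesis .
qed

lemma floor_log_bounds:
  assumes "x \<ge> 1"
  shows "2 ^ floor_log x \<le> x" "x < 2 ^ Suc (floor_log x)"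
  using assms floor_log_exp2_le[of x] floor_log_exp2_gt[of x] by auto

text \<open>Elements with equal \<open>floor_log\<close> share a dyadic block, and each block
  contributes at most 1.\<close>

lemma sum_inverse_le_card_floor_log:
  fixes Z :: "nat set"
  assumes "finite Z" "Z \<subseteq> {1..}"
  shows "(\<Sum>x\<in>Z. 1 / real x) \<le> card (floor_log ` Z)"
proof -
  have "(\<Sum>x\<in>Z. 1 / real x) = (\<Sum>i\<in>floor_log ` Z. \<Sum>x\<in>{x \<in> Z. floor_log x = i}. 1 / real x)"
    using assms(1) by (rule sum.image_gen)
  also have "\<dots> \<le> (\<Sum>i\<in>floor_log ` Z. 1)"
  proof (rule sum_mono)
    fix i
    have "(\<Sum>x\<in>{x \<in> Z. floor_log x = i}. 1 / real x) \<le> (\<Sum>x\<in>{2 ^ i..<2 ^ Suc i}. 1 / real x)"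
      by (rule sum_mono2) (use assms(2) floor_log_bounds in fastforce)+
    then show "(\<Sum>x\<in>{x \<in> Z. floor_log x = i}. 1 / real x) \<le> 1"
      using sum_inverse_dyadic_block_le[of i] by linarith
  qed
  finally show ?thesis by simp
qed

lemma floor_log_mult_le:
  assumes "a \<ge> 1" "b \<ge> 1"
  shows "floor_log (a * b) \<le> floor_log a + floor_log b + 1"
proof -
  have "2 ^ floor_log (a * b) \<le> a * b"
    using assms by (intro floor_log_bounds) simp
  also have "\<dots> < 2 ^ Suc (floor_log a) * 2 ^ Suc (floor_log b)"
    using assms floor_log_bounds by (intro mult_strict_mono) auto
  also have "\<dots> = 2 ^ (Suc (floor_log a) + Suc (floor_log b))"
    by (simp add: power_add)
  finally have "floor_log (a * b) < Suc (floor_log a) + Suc (floor_log b)"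
    by (rule power_less_imp_less_exp[rotated]) simp
  then show ?thesis by simp
qed

text \<open>A reciprocal sum of at least e ln n over [k, nk] forces at least e ln n distinct values
  of \<open>floor_log\<close>, all in a window of floor_log n + 2 integers.\<close>

lemma lBD_pos_imp_dense_blocks:
  assumes A: "A \<subseteq> {1..}" and "lBD A > 0"
  shows "\<exists>a>0. dense_blocks a ((int \<circ> floor_log) ` A)"
proof -
  obtain e where e: "e > 0"
    and dense: "\<And>N. \<exists>n\<ge>N. \<exists>k\<ge>1. e * ln (real n) \<le> (\<Sum>x\<in>A \<inter> {k..n * k}. 1 / real x)"
    using lBD_pos_imp_dense_intervals[OF assms(2)] by blast
  define X where "X = (int \<circ> floor_log) ` A"
  have "\<exists>L\<ge>N. \<exists>p. e * ln 2 / 2 * real L \<le> card (X \<inter> {p..<p + int L})" for N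
  proof -
    \<comment> \<open>The exponent gives L \<ge> N and floor_log n \<ge> 2. The latter yields L
      \<le> 2 floor_log n, whence the factor 1/2 in the density.\<close>
    obtain n k where n: "n \<ge> 2 ^ max N 2" and k: "k \<ge> 1"
      and sum: "e * ln (real n) \<le> (\<Sum>x\<in>A \<inter> {k..n * k}. 1 / real x)"
      using dense by blast
    define Z where "Z = A \<inter> {k..n * k}"
    define L where "L = floor_log n + 2"
    have n1: "n \<ge> 1" using n by (metis le_trans one_le_numeral one_le_power)
    have "max N 2 \<le> floor_log n"
      using floor_log_le_iff[OF n] by simp
    then have L: "L \<ge> N" "L \<ge> 4" by (auto simp: L_def)
    have "int ` floor_log ` Z \<subseteq> X \<inter> {int (floor_log k)..<int (floor_log k) + int L}"
    proof (intro subsetI)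
      fix w assume "w \<in> int ` floor_log ` Z"
      then obtain x where x: "x \<in> A" "k \<le> x" "x \<le> n * k" "w = int (floor_log x)"
        by (auto simp: Z_def)
      have "floor_log k \<le> floor_log x" "floor_log x \<le> floor_log (n * k)"
        using x floor_log_le_iff by auto
      moreover have "floor_log (n * k) \<le> floor_log n + floor_log k + 1"
        using floor_log_mult_le n1 k by blast
      ultimately show "w \<in> X \<inter> {int (floor_log k)..<int (floor_log k) + int L}"
        using x by (auto simp: X_def L_def)
    qed
    then have "card (int ` floor_log ` Z) \<le> card (X \<inter> {int (floor_log k)..<int (floor_log k) + int L})"
      by (intro card_mono) auto
    then have "real (card (floor_log ` Z)) \<le> card (X \<inter> {int (floor_log k)..<int (floor_log k) + int L})"
      by (simp add: card_image)
    moreover have "e * ln (real n) \<le> card (floor_log ` Z)"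
    proof -
      have "(\<Sum>x\<in>Z. 1 / real x) \<le> card (floor_log ` Z)"
        using A by (intro sum_inverse_le_card_floor_log) (auto simp: Z_def)
      then show ?thesis using sum unfolding Z_def by linarith
    qed
    moreover have "e * ln 2 / 2 * real L \<le> e * ln (real n)"
    proof -
      have "2 ^ floor_log n \<le> real n"
        using floor_log_bounds(1)[OF n1] by simp
      then have "ln (2 ^ floor_log n) \<le> ln (real n)"
        using n1 by (subst ln_le_cancel_iff) auto
      then have "real (floor_log n) * ln 2 \<le> ln (real n)"
        by (simp add: ln_realpow)
      moreover have "real L / 2 * ln 2 \<le> real (floor_log n) * ln 2"
        using L by (intro mult_right_mono) (auto simp: L_def)
      ultimately have "real L / 2 * ln 2 \<le> ln (real n)" by linarith
      then have "e * (real L / 2 * ln 2) \<le> e * ln (real n)"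
        using e by (intro mult_left_mono) auto
      then show ?thesis by (simp add: algebra_simps)
    qed
    ultimately have "e * ln 2 / 2 * real L \<le> card (X \<inter> {int (floor_log k)..<int (floor_log k) + int L})"
      by linarith
    then show ?thesis using L(1) by blast
  qed
  then have "dense_blocks (e * ln 2 / 2) X"
    by (simp add: dense_blocks_def)
  moreover have "e * ln 2 / 2 > 0" using e by simp
  ultimately show ?thesis unfolding X_def by blast
qed

section \<open>Return from sums of logarithms to products\<close>

theorem theorem6p8:
  fixes A B :: "nat set"
  assumes "A \<subseteq> {1..}" and "B \<subseteq> {1..}"
    and "lBD A > 0" and "lBD B > 0"
  shows "\<exists>m\<ge>1. \<forall>n\<ge>1. \<exists>x\<ge>1. \<forall>u\<ge>1.
    {u..m * u} \<subseteq> {x..n * x} \<longrightarrow> {u..m * u} \<inter> (A * B) \<noteq> {}"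
proof -
  define X Y where "X = (int \<circ> floor_log) ` A" and "Y = (int \<circ> floor_log) ` B"
  obtain a b where ab: "a > 0" "b > 0" "dense_blocks a X" "dense_blocks b Y"
    using lBD_pos_imp_dense_blocks assms unfolding X_def Y_def by metis
  obtain m :: nat where m: "m \<ge> 1"
    "\<And>n::nat. \<exists>x. \<forall>y\<ge>x. y + int m \<le> x + int n \<longrightarrow> {y..<y + int m} \<inter> (X + Y) \<noteq> {}"
    using sumset_piecewise_syndetic[OF ab(3,4,1,2)] by blast
  \<comment> \<open>Of the exponent m + 2, \<open>m\<close> is the gap bound for
    \<open>X + Y\<close>; the 2 pays for rounding down the logarithms of both factors.\<close>
  have "\<exists>x\<ge>1. \<forall>u\<ge>1. {u..2 ^ (m + 2) * u} \<subseteq> {x..n * x} \<longrightarrow> {u..2 ^ (m + 2) * u} \<inter> (A * B) \<noteq> {}"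
    if n: "n \<ge> 1" for n
  proof -
    obtain x where x: "\<And>y. y \<ge> x \<Longrightarrow> y + int m \<le> x + int (floor_log n + 1 + m) \<Longrightarrow>
        {y..<y + int m} \<inter> (X + Y) \<noteq> {}"
      using m(2)[of "floor_log n + 1 + m"] by blast
    \<comment> \<open>The integer \<open>x\<close> may be negative, but \<open>X + Y\<close> has no
      negative elements and meets this interval. Hence x + m is a natural number \<open>h\<close>,
      and 2 ^ h is the witness sought.\<close>
    have "{x..<x + int m} \<inter> (X + Y) \<noteq> {}"
      using x by simp
    then have "x + int m \<ge> 0"
      by (auto simp: X_def Y_def elim!: set_plus_elim)
    then obtain h where h: "int h = x + int m"
      using nonneg_eq_int by metis
    have "{u..2 ^ (m + 2) * u} \<inter> (A * B) \<noteq> {}"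
      if u: "u \<ge> 1" and sub: "{u..2 ^ (m + 2) * u} \<subseteq> {2 ^ h..n * 2 ^ h}" for u
    proof -
      define e where "e = floor_log u"
      have e: "2 ^ e \<le> u" "u < 2 ^ Suc e"
        using floor_log_bounds u unfolding e_def by auto
      have "u \<le> 2 ^ (m + 2) * u" by simp
      then have u_bounds: "2 ^ h \<le> u" "2 ^ (m + 2) * u \<le> n * 2 ^ h"
        using sub by (auto simp: subset_iff)
      have "(2::nat) ^ h < 2 ^ Suc e" using u_bounds(1) e(2) by linarith
      then have "h < Suc e" by (rule power_less_imp_less_exp[rotated]) simp
      have "(2::nat) ^ (m + 2 + e) \<le> 2 ^ (m + 2) * u"
        using e(1) by (simp add: power_add)
      also have "\<dots> \<le> n * 2 ^ h" by (rule u_bounds(2))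
      also have "\<dots> < 2 ^ Suc (floor_log n) * 2 ^ h"
        using floor_log_bounds(2)[OF n] by simp
      also have "\<dots> = 2 ^ (Suc (floor_log n) + h)" by (simp add: power_add)
      finally have "m + 2 + e < Suc (floor_log n) + h"
        by (rule power_less_imp_less_exp[rotated]) simp
      \<comment> \<open>Starting at e + 1 rather than e ensures that the product is at least 2 ^ (e
        + 1), hence at least \<open>u\<close>.\<close>
      then have "{int e + 1..<int e + 1 + int m} \<inter> (X + Y) \<noteq> {}"
        using h \<open>h < Suc e\<close> by (intro x) auto
      then obtain c d where cd: "c \<in> A" "d \<in> B" "e + 1 \<le> floor_log c + floor_log d"
        "floor_log c + floor_log d \<le> e + m"
        by (fastforce simp: X_def Y_def elim!: set_plus_elim)
      have c1: "c \<ge> 1" and d1: "d \<ge> 1" using cd assms by auto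
      have "u \<le> 2 ^ (e + 1)" using e(2) by simp
      also have "\<dots> \<le> 2 ^ (floor_log c + floor_log d)"
        using cd(3) by (intro power_increasing) auto
      also have "\<dots> \<le> c * d"
        using floor_log_bounds(1) c1 d1 unfolding power_add by (intro mult_mono) auto
      finally have "u \<le> c * d" .
      moreover have "c * d \<le> 2 ^ Suc (floor_log c) * 2 ^ Suc (floor_log d)"
        using floor_log_bounds(2) c1 d1 by (intro mult_mono) (auto intro: less_imp_le)
      then have "c * d \<le> 2 ^ (floor_log c + floor_log d + 2)"
        by (simp add: power_add)
      then have "c * d \<le> 2 ^ (e + m + 2)"
        using cd(4) by (elim order.trans) (intro power_increasing, auto)
      then have "c * d \<le> 2 ^ (m + 2) * 2 ^ e"
        by (simp add: power_add mult_ac)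
      then have "c * d \<le> 2 ^ (m + 2) * u"
        using e(1) by (elim order.trans) (intro mult_left_mono, auto)
      moreover have "c * d \<in> A * B" using cd by (intro set_times_intro)
      ultimately show ?thesis by auto
    qed
    then show ?thesis
      by (intro exI[of _ "2 ^ h"]) auto
  qed
  then show ?thesis
    by (intro exI[of _ "2 ^ (m + 2)"]) auto
qed

end
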